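(* (i) For $n\geq 1$, the sequence of coefficients of the lacking polynomial $L_{2,n}(x)$ of $K_{2,n}$ is log-concave. (ii) For $m\geq 1$, the sequence of coefficients of the lacking polynomial $L_{m,2}(x)$ of $K_{m,2}$ is log-concave.
   Context: $K_{2,n}$ is the complete bipartite graph with parts $\{v_0,v_1\}$ and $\{v_2,\ldots,v_{n+1}\}$; $K_{m,2}$ is the complete bipartite graph with parts $\{v_0,\ldots,v_{m-1}\}$ and $\{v_m,v_{m+1}\}$; in both the sink is $v_0$. For a finite connected loop-free graph $G$ with sink $s$: a configuration assigns a non-negative integer $c(v)$ to each non-sink vertex; it is stable if $c(v)<d(v)$ (degree) for all non-sink $v$; for an orientation $\mathcal{O}$ of $G$, $c$ is compatible with $\mathcal{O}$ if $\mathrm{in}_{\mathcal{O}}(v)\geq d(v)-c(v)$ for all non-sink $v$, where $\mathrm{in}_{\mathcal{O}}(v)$ is the in-degree. $\mathsf{Sto}(G)$ is the set of stable configurations compatible with some orientation. The lacking polynomial is $L_G(x)=\sum_{c\in\mathsf{Sto}(G)}x^{\ell(c)}$ with $\ell(c)=\sum_{v\neq s}(d(v)-c(v)-1)$. A sequence $a_0,\ldots,a_N$ of non-negative reals is log-concave if $a_k^2\geq a_{k-1}a_{k+1}$ for all $0<k<N$; the coefficient sequence of a polynomial of degree $N$ is $(a_0,\ldots,a_N)$ where $a_k$ is the coefficient of $x^k$. *)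

theory Defs
  imports "HOL-Computational_Algebra.Polynomial" "HOL-Library.FuncSet"
begin

text \<open>
  A finite loop-free graph is given by its vertex set \<open>V\<close> and its set \<open>E\<close> of edges,
  each edge being a two-element subset of \<open>V\<close>.
\<close>

definition vdeg :: "'a set set \<Rightarrow> 'a \<Rightarrow> nat" where
  "vdeg E v = card {e \<in> E. v \<in> e}"

text \<open>An orientation is the set of its arcs \<open>(u, v)\<close>, directed from \<open>u\<close> to \<open>v\<close>.\<close>

definition orientation :: "'a set set \<Rightarrow> ('a \<times> 'a) set \<Rightarrow> bool" where
  "orientation E A \<longleftrightarrow>
     (\<forall>u v. (u, v) \<in> A \<longrightarrow> {u, v} \<in> E) \<and>
     (\<forall>u v. {u, v} \<in> E \<longrightarrow> ((u, v) \<in> A \<longleftrightarrow> (v, u) \<notin> A))"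

definition indeg :: "('a \<times> 'a) set \<Rightarrow> 'a \<Rightarrow> nat" where
  "indeg A v = card {u. (u, v) \<in> A}"

text \<open>
  Configurations are extensional functions (\<open>undefined\<close> outside the non-sink vertices),
  so that each configuration is represented by exactly one function.
\<close>

definition configurations :: "'a set \<Rightarrow> 'a \<Rightarrow> ('a \<Rightarrow> nat) set" where
  "configurations V s = (V - {s}) \<rightarrow>\<^sub>E UNIV"

definition stable :: "'a set \<Rightarrow> 'a set set \<Rightarrow> 'a \<Rightarrow> ('a \<Rightarrow> nat) \<Rightarrow> bool" where
  "stable V E s c \<longleftrightarrow> (\<forall>v \<in> V - {s}. c v < vdeg E v)"

definition compatible ::
  "'a set \<Rightarrow> 'a set set \<Rightarrow> 'a \<Rightarrow> ('a \<Rightarrow> nat) \<Rightarrow> ('a \<times> 'a) set \<Rightarrow> bool" where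
  "compatible V E s c A \<longleftrightarrow>
     (\<forall>v \<in> V - {s}. int (indeg A v) \<ge> int (vdeg E v) - int (c v))"

definition Sto :: "'a set \<Rightarrow> 'a set set \<Rightarrow> 'a \<Rightarrow> ('a \<Rightarrow> nat) set" where
  "Sto V E s =
     {c \<in> configurations V s. stable V E s c \<and> (\<exists>A. orientation E A \<and> compatible V E s c A)}"

text \<open>For stable \<open>c\<close> the subtractions on natural numbers below do not truncate.\<close>

definition lack :: "'a set \<Rightarrow> 'a set set \<Rightarrow> 'a \<Rightarrow> ('a \<Rightarrow> nat) \<Rightarrow> nat" where
  "lack V E s c = (\<Sum>v \<in> V - {s}. vdeg E v - c v - 1)"

definition lacking_poly :: "'a set \<Rightarrow> 'a set set \<Rightarrow> 'a \<Rightarrow> real poly" where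
  "lacking_poly V E s = (\<Sum>c \<in> Sto V E s. monom 1 (lack V E s c))"

lemma finite_Sto:
  assumes "finite V"
  shows "finite (Sto V E s)"
proof (rule finite_subset)
  show "Sto V E s \<subseteq> (\<Pi>\<^sub>E v \<in> V - {s}. {..<vdeg E v})"
    by (auto simp: Sto_def configurations_def stable_def PiE_iff extensional_def)
  show "finite (\<Pi>\<^sub>E v \<in> V - {s}. {..<vdeg E v})"
    using assms by (intro finite_PiE) auto
qed

definition K_verts :: "nat \<Rightarrow> nat \<Rightarrow> nat set" where
  "K_verts m n = {0..<m + n}"

definition K_edges :: "nat \<Rightarrow> nat \<Rightarrow> nat set set" where
  "K_edges m n = {{i, j} | i j. i \<in> {0..<m} \<and> j \<in> {m..<m + n}}"

definition K_lacking_poly :: "nat \<Rightarrow> nat \<Rightarrow> real poly" where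
  "K_lacking_poly m n = lacking_poly (K_verts m n) (K_edges m n) 0"

text \<open>Log-concavity of the finite sequence \<open>a 0, \<dots>, a N\<close>.\<close>

definition log_concave :: "nat \<Rightarrow> (nat \<Rightarrow> real) \<Rightarrow> bool" where
  "log_concave N a \<longleftrightarrow>
     (\<forall>k \<le> N. a k \<ge> 0) \<and> (\<forall>k. 0 < k \<and> k < N \<longrightarrow> (a k)\<^sup>2 \<ge> a (k - 1) * a (k + 1))"

definition log_concave_coeffs :: "real poly \<Rightarrow> bool" where
  "log_concave_coeffs p \<longleftrightarrow> log_concave (degree p) (coeff p)"

end

theory Submission
  imports Defs
begin

text \<open>
  Write \<open>l v = d v - c v - 1\<close>. Counting arcs, every configuration in \<open>Sto\<close> satisfies
  \<open>\<Sum> l v \<le> |E| - |V| + 1\<close>. For the two families at hand this bound \<open>N\<close> is also sufficient for a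
  stable configuration, since vertices of degree 2 with \<open>l v = 0\<close> can forward one edge. Hence for
  \<open>j \<le> N\<close> the coefficient of \<open>x ^ j\<close> agrees with that of \<open>(1 + x) ^ |W| / (1 - x) ^ |U|\<close>, where \<open>W\<close>
  is the part of non-sink vertices of degree 2 and \<open>U\<close> the remaining one or two non-sink vertices.
  These coefficients are (iterated) partial sums of a row of binomial coefficients, and taking
  partial sums preserves log-concavity.
\<close>

section \<open>Log-concavity of partial sums\<close>

text \<open>The hypothesis \<open>lc\<close> says that the ratios \<open>a (Suc k) / a k\<close> do
  not increase. The induction multiplies the cross inequality for \<open>j\<close> by
  \<open>lc\<close> at \<open>j\<close> and cancels \<open>a j * a (Suc j)\<close>, which is where
  strict positivity enters.\<close>

lemma log_concave_cross:
  fixes a :: "nat \<Rightarrow> real"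
  assumes pos: "\<And>k. a k > 0"
    and lc: "\<And>k. a k * a (Suc (Suc k)) \<le> (a (Suc k))\<^sup>2"
    and "i \<le> j"
  shows "a i * a (Suc j) \<le> a (Suc i) * a j"
  using \<open>i \<le> j\<close>
proof (induction j rule: dec_induct)
  case base
  show ?case by simp
next
  case (step j)
  have "(a i * a (Suc (Suc j))) * (a j * a (Suc j)) = (a i * a (Suc j)) * (a j * a (Suc (Suc j)))"
    by (simp add: algebra_simps)
  also have "\<dots> \<le> (a (Suc i) * a j) * (a (Suc j))\<^sup>2"
    by (rule mult_mono) (use step.IH lc pos in \<open>simp_all add: less_imp_le\<close>)
  also have "\<dots> = (a (Suc i) * a (Suc j)) * (a j * a (Suc j))"
    by (simp add: power2_eq_square algebra_simps)
  finally show ?case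
    using mult_le_cancel_right_pos[OF mult_pos_pos[OF pos pos]] by blast
qed

text \<open>Writing \<open>S\<close> for the partial sums, the claim expands to
  \<open>S k * a (k + 2) \<le> S (k + 1) * a (k + 1)\<close>. This follows by applying
  \<open>cross\<close> to each summand of \<open>S k\<close>.\<close>

lemma log_concave_partial_sums:
  fixes a :: "nat \<Rightarrow> real"
  assumes nonneg: "\<And>k. a k \<ge> 0"
    and cross: "\<And>i j. i \<le> j \<Longrightarrow> a i * a (Suc j) \<le> a (Suc i) * a j"
  shows "(\<Sum>i\<le>k. a i) * (\<Sum>i\<le>Suc (Suc k). a i) \<le> (\<Sum>i\<le>Suc k. a i)\<^sup>2"
proof -
  let ?S = "\<lambda>k. \<Sum>i\<le>k. a i"
  have "?S k * a (Suc (Suc k)) = (\<Sum>i\<le>k. a i * a (Suc (Suc k)))"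
    by (simp add: sum_distrib_right)
  also have "\<dots> \<le> (\<Sum>i\<le>k. a (Suc i) * a (Suc k))"
    by (intro sum_mono cross) simp
  also have "\<dots> = (\<Sum>i\<le>k. a (Suc i)) * a (Suc k)"
    by (simp add: sum_distrib_right)
  \<comment> \<open>The shifted sum is \<open>?S (Suc k)\<close> without its first term
    \<open>a 0\<close>, which is nonnegative.\<close>
  also have "\<dots> \<le> ?S (Suc k) * a (Suc k)"
    using nonneg by (intro mult_right_mono) (simp_all add: sum.atMost_Suc_shift del: sum.atMost_Suc)
  finally show ?thesis
    by (simp add: power2_eq_square algebra_simps)
qed

text \<open>Multiplying both sides by \<open>Suc i * Suc j\<close> and absorbing reduces the claim
  to \<open>Suc i * (n - j) \<le> Suc j * (n - i)\<close>. The direct proof covers the zero entries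
  beyond \<open>n\<close>, to which \<open>log_concave_cross\<close> does not apply.\<close>

lemma binomial_cross:
  assumes "i \<le> j"
  shows "(n choose i) * (n choose Suc j) \<le> (n choose Suc i) * (n choose j)"
proof -
  have absorb: "Suc k * (n choose Suc k) = (n - k) * (n choose k)" for k
    by (metis binomial_absorb_comp binomial_absorption)
  have "(Suc i * Suc j) * ((n choose i) * (n choose Suc j))
      = (Suc i * (n choose i)) * (Suc j * (n choose Suc j))"
    by (simp only: mult_ac)
  also have "\<dots> = (Suc i * (n - j)) * ((n choose i) * (n choose j))"
    by (simp only: absorb mult_ac)
  also have "\<dots> \<le> (Suc j * (n - i)) * ((n choose i) * (n choose j))"
    using assms by (intro mult_right_mono mult_mono) auto
  also have "\<dots> = (Suc j * (n choose j)) * (Suc i * (n choose Suc i))"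
    by (simp only: absorb mult_ac)
  also have "\<dots> = (Suc i * Suc j) * ((n choose Suc i) * (n choose j))"
    by (simp only: mult_ac)
  finally show ?thesis
    by (simp only: mult_le_cancel1) simp
qed

lemma binomial_sum_log_concave:
  fixes n k :: nat
  defines "S \<equiv> \<lambda>k. \<Sum>i\<le>k. real (n choose i)"
  shows "S k * S (Suc (Suc k)) \<le> (S (Suc k))\<^sup>2"
  unfolding S_def
proof (rule log_concave_partial_sums)
  fix i j :: nat assume "i \<le> j"
  then show "real (n choose i) * real (n choose Suc j) \<le> real (n choose Suc i) * real (n choose j)"
    using binomial_cross[of i j n] by (metis of_nat_mult of_nat_le_iff)
qed simp

text \<open>The single sums are strictly positive because they contain \<open>n choose 0\<close>. So
  \<open>log_concave_cross\<close> turns their log-concavity into the cross inequality required by a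
  second summation.\<close>

lemma binomial_double_sum_log_concave:
  fixes n k :: nat
  defines "T \<equiv> \<lambda>k. \<Sum>j\<le>k. \<Sum>i\<le>j. real (n choose i)"
  shows "T k * T (Suc (Suc k)) \<le> (T (Suc k))\<^sup>2"
  unfolding T_def
proof (rule log_concave_partial_sums)
  have pos: "(\<Sum>i\<le>k. real (n choose i)) > 0" for k
    by (rule sum_pos2[of _ 0]) auto
  then show "(\<Sum>i\<le>k. real (n choose i)) \<ge> 0" for k
    by (simp add: less_imp_le)
  show "(\<Sum>i\<le>i. real (n choose i)) * (\<Sum>i\<le>Suc j. real (n choose i))
      \<le> (\<Sum>i\<le>Suc i. real (n choose i)) * (\<Sum>i\<le>j. real (n choose i))" if "i \<le> j" for i j
    using log_concave_cross[of "\<lambda>k. \<Sum>i\<le>k. real (n choose i)", OF pos binomial_sum_log_concave that] .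
qed

text \<open>Here \<open>p\<close> is a truncation of a log-concave sequence \<open>f\<close>. The
  bound \<open>degree p \<le> N\<close> suffices: if \<open>k < degree p\<close>, then
  \<open>k + 1 \<le> N\<close>, so all three coefficients are values of \<open>f\<close>.\<close>

lemma log_concave_coeffsI:
  assumes coeff: "\<And>j. coeff p j = (if j \<le> N then f j else 0)"
    and nonneg: "\<And>j. f j \<ge> 0"
    and lc: "\<And>k. f k * f (Suc (Suc k)) \<le> (f (Suc k))\<^sup>2"
  shows "log_concave_coeffs p"
  unfolding log_concave_coeffs_def log_concave_def
proof (intro conjI allI impI)
  show "coeff p k \<ge> 0" for k
    using nonneg by (simp add: coeff)
  have deg: "degree p \<le> N"
    by (rule degree_le) (simp add: coeff)
  fix k assume "0 < k \<and> k < degree p"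
  then show "coeff p (k - 1) * coeff p (k + 1) \<le> (coeff p k)\<^sup>2"
    using deg lc[of "k - 1"] by (simp add: coeff)
qed

section \<open>Counting lack vectors\<close>

text \<open>For finite disjoint \<open>W\<close> and \<open>U\<close>, the number of these vectors
  is the coefficient of \<open>x ^ j\<close> in \<open>(1 + x) ^ |W| / (1 - x) ^ |U|\<close>.
  Entries on \<open>U\<close> carry no cap of their own; the total \<open>j\<close> bounds
  them.\<close>

definition lack_vectors :: "'a set \<Rightarrow> 'a set \<Rightarrow> nat \<Rightarrow> ('a \<Rightarrow> nat) set" where
  "lack_vectors W U j =
     {f \<in> (W \<union> U) \<rightarrow>\<^sub>E UNIV. (\<forall>w\<in>W. f w \<le> 1) \<and> sum f (W \<union> U) = j}"

lemma finite_lack_vectors: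
  assumes "finite W" "finite U"
  shows "finite (lack_vectors W U j)"
proof (rule finite_subset)
  show "lack_vectors W U j \<subseteq> (\<Pi>\<^sub>E v \<in> W \<union> U. {..j})"
  proof
    fix f assume f: "f \<in> lack_vectors W U j"
    have "f v \<le> j" if "v \<in> W \<union> U" for v
      using f that assms member_le_sum[of v "W \<union> U" f] by (simp add: lack_vectors_def)
    then show "f \<in> (\<Pi>\<^sub>E v \<in> W \<union> U. {..j})"
      using f by (simp add: lack_vectors_def PiE_iff)
  qed
  show "finite (\<Pi>\<^sub>E v \<in> W \<union> U. {..j})"
    using assms by (intro finite_PiE) auto
qed

text \<open>The vectors are the indicator functions of the \<open>j\<close>-element subsets of
  \<open>W\<close>.\<close>

lemma card_lack_vectors_empty:
  assumes "finite W"
  shows "card (lack_vectors W {} j) = card W choose j"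
proof -
  have "bij_betw (\<lambda>S. \<lambda>w\<in>W. if w \<in> S then 1 else 0)
          {S. S \<subseteq> W \<and> card S = j} (lack_vectors W {} j)"
  proof (rule bij_betw_byWitness[where f' = "\<lambda>f. {w \<in> W. f w = 1}"])
    show "\<forall>f \<in> lack_vectors W {} j. (\<lambda>w\<in>W. if w \<in> {w \<in> W. f w = 1} then 1 else 0) = f"
    proof
      fix f assume "f \<in> lack_vectors W {} j"
      then have "f \<in> extensional W" "\<forall>w\<in>W. f w \<le> 1"
        by (auto simp: lack_vectors_def PiE_iff)
      then show "(\<lambda>w\<in>W. if w \<in> {w \<in> W. f w = 1} then 1 else 0) = f"
        by (intro extensionalityI[of _ W]) (auto simp: le_Suc_eq)
    qed
    show "(\<lambda>S. \<lambda>w\<in>W. if w \<in> S then 1 else 0) ` {S. S \<subseteq> W \<and> card S = j} \<subseteq> lack_vectors W {} j"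
    proof (clarify)
      fix S assume "S \<subseteq> W" "j = card S"
      then show "(\<lambda>w\<in>W. if w \<in> S then 1 else 0) \<in> lack_vectors W {} (card S)"
        using assms by (auto simp: lack_vectors_def sum.If_cases Int_absorb1)
    qed
    show "(\<lambda>f. {w \<in> W. f w = 1}) ` lack_vectors W {} j \<subseteq> {S. S \<subseteq> W \<and> card S = j}"
    proof (clarify, intro conjI)
      fix f assume f: "f \<in> lack_vectors W {} j"
      then have "sum f W = (\<Sum>w\<in>W. if f w = 1 then 1 else 0)"
        by (intro sum.cong) (auto simp: lack_vectors_def le_Suc_eq)
      then show "card {w \<in> W. f w = 1} = j"
        using f assms by (simp add: lack_vectors_def sum.If_cases Int_def)
    qed auto
  qed auto
  then show ?thesis
    using n_subsets[OF assms, of j] by (simp add: bij_betw_same_card)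
qed

text \<open>The entry at \<open>u\<close> is determined by the others and the total
  \<open>j\<close>, so deleting it leaves an arbitrary vector of total at most \<open>j\<close>.
  This is multiplication of the generating function by \<open>1 / (1 - x)\<close>.\<close>

lemma card_lack_vectors_insert:
  assumes "finite W" "finite U" "u \<notin> W \<union> U"
  shows "card (lack_vectors W (insert u U) j) = (\<Sum>i\<le>j. card (lack_vectors W U i))"
proof -
  let ?A = "W \<union> U"
  have ins: "W \<union> insert u U = insert u ?A" by auto
  have sum_upd: "sum (g(u := x)) (insert u ?A) = x + sum g ?A" for g :: "'a \<Rightarrow> nat" and x
  proof -
    have "sum (g(u := x)) ?A = sum g ?A"
      using assms by (intro sum.cong) auto
    then show ?thesis using assms by simp
  qed
  have "bij_betw (\<lambda>g. g(u := j - sum g ?A)) (\<Union>i\<le>j. lack_vectors W U i)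
          (lack_vectors W (insert u U) j)"
  proof (rule bij_betw_byWitness[where f' = "\<lambda>f. restrict f ?A"])
    show "\<forall>g \<in> (\<Union>i\<le>j. lack_vectors W U i). restrict (g(u := j - sum g ?A)) ?A = g"
      using assms by (auto simp: lack_vectors_def PiE_iff intro!: extensionalityI[of _ ?A])
    show "\<forall>f \<in> lack_vectors W (insert u U) j.
            (restrict f ?A)(u := j - sum (restrict f ?A) ?A) = f"
    proof
      fix f assume "f \<in> lack_vectors W (insert u U) j"
      then have "f \<in> extensional (insert u ?A)" "j = f u + sum f ?A"
        using assms by (auto simp: lack_vectors_def PiE_iff)
      then show "(restrict f ?A)(u := j - sum (restrict f ?A) ?A) = f"
        by (intro extensionalityI[of _ "insert u ?A"]) (auto simp: extensional_def)
    qed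
    show "(\<lambda>g. g(u := j - sum g ?A)) ` (\<Union>i\<le>j. lack_vectors W U i)
            \<subseteq> lack_vectors W (insert u U) j"
      using assms by (auto simp: lack_vectors_def ins sum_upd PiE_iff extensional_def
          simp del: sum.insert fun_upd_apply) auto
    show "(\<lambda>f. restrict f ?A) ` lack_vectors W (insert u U) j \<subseteq> (\<Union>i\<le>j. lack_vectors W U i)"
      using assms by (auto simp: lack_vectors_def)
  qed
  then have "card (lack_vectors W (insert u U) j) = card (\<Union>i\<le>j. lack_vectors W U i)"
    by (simp add: bij_betw_same_card)
  also have "\<dots> = (\<Sum>i\<le>j. card (lack_vectors W U i))"
    using finite_lack_vectors assms
    by (intro card_UN_disjoint) (auto simp: lack_vectors_def)
  finally show ?thesis .
qed

text \<open>Passing from \<open>c\<close> to its vector of lacks is a bijection once membership in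
  \<open>Sto\<close> depends only on the total lack.\<close>

lemma coeff_lacking_poly:
  assumes "finite V" and V: "V - {s} = W \<union> U"
    and degW: "\<And>w. w \<in> W \<Longrightarrow> vdeg E w = 2"
    and degU: "\<And>u. u \<in> U \<Longrightarrow> vdeg E u = Suc N"
    and Sto: "\<And>c. c \<in> configurations V s \<Longrightarrow> stable V E s c \<Longrightarrow>
      (\<exists>A. orientation E A \<and> compatible V E s c A) \<longleftrightarrow> lack V E s c \<le> N"
  shows "coeff (lacking_poly V E s) j = (if j \<le> N then real (card (lack_vectors W U j)) else 0)"
proof -
  have "coeff (lacking_poly V E s) j = (\<Sum>c\<in>Sto V E s. if lack V E s c = j then 1 else 0)"
    by (simp add: lacking_poly_def coeff_sum)
  also have "\<dots> = real (card {c \<in> Sto V E s. lack V E s c = j})"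
    using finite_Sto[OF \<open>finite V\<close>, of E s] by (simp add: sum.If_cases Int_def)
  finally have coeff: "coeff (lacking_poly V E s) j = real (card {c \<in> Sto V E s. lack V E s c = j})" .
  show ?thesis
  proof (cases "j \<le> N")
    case False
    then have "{c \<in> Sto V E s. lack V E s c = j} = {}"
      using Sto by (auto simp: Sto_def)
    then have "card {c \<in> Sto V E s. lack V E s c = j} = 0" by (simp only: card.empty)
    then show ?thesis using False coeff by simp
  next
    case True
    let ?\<phi> = "\<lambda>c. \<lambda>v\<in>W \<union> U. vdeg E v - c v - 1"
    have fin: "finite (W \<union> U)"
      using \<open>finite V\<close> V by (metis finite_Diff)
    \<comment> \<open>On \<open>U\<close> an entry is at most the total \<open>j \<le> N\<close>,
      hence below the degree \<open>Suc N\<close>.\<close>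
    have bound: "f v < vdeg E v" if "f \<in> lack_vectors W U j" "v \<in> W \<union> U" for f v
    proof (cases "v \<in> W")
      case True
      then have "f v \<le> 1" using that by (auto simp: lack_vectors_def)
      then show ?thesis using degW True by simp
    next
      case False
      have "f v \<le> sum f (W \<union> U)"
        using fin that by (intro member_le_sum) auto
      then have "f v \<le> j" using that by (simp add: lack_vectors_def)
      then show ?thesis using degU False that \<open>j \<le> N\<close> by auto
    qed
    \<comment> \<open>Below the degrees, \<open>d - (d - x - 1) - 1 = x\<close>, so
      \<open>?\<phi>\<close> serves as its own inverse.\<close>
    have "bij_betw ?\<phi> {c \<in> Sto V E s. lack V E s c = j} (lack_vectors W U j)"
    proof (rule bij_betw_byWitness[where f' = ?\<phi>])
      show "\<forall>c \<in> {c \<in> Sto V E s. lack V E s c = j}. ?\<phi> (?\<phi> c) = c"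
      proof
        fix c assume "c \<in> {c \<in> Sto V E s. lack V E s c = j}"
        then have "c \<in> extensional (W \<union> U)" and st: "\<And>v. v \<in> W \<union> U \<Longrightarrow> c v < vdeg E v"
          by (auto simp: Sto_def configurations_def stable_def V PiE_iff)
        then show "?\<phi> (?\<phi> c) = c"
        proof (intro extensionalityI[of _ "W \<union> U"])
          fix v assume "v \<in> W \<union> U"
          then show "?\<phi> (?\<phi> c) v = c v" using st[of v] by simp
        qed auto
      qed
      show "\<forall>f \<in> lack_vectors W U j. ?\<phi> (?\<phi> f) = f"
      proof
        fix f assume f: "f \<in> lack_vectors W U j"
        then have "f \<in> extensional (W \<union> U)"
          by (simp add: lack_vectors_def PiE_iff)
        then show "?\<phi> (?\<phi> f) = f"
        proof (intro extensionalityI[of _ "W \<union> U"])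
          fix v assume "v \<in> W \<union> U"
          then show "?\<phi> (?\<phi> f) v = f v" using bound[OF f, of v] by simp
        qed auto
      qed
      show "?\<phi> ` {c \<in> Sto V E s. lack V E s c = j} \<subseteq> lack_vectors W U j"
      proof (rule image_subsetI)
        fix c assume "c \<in> {c \<in> Sto V E s. lack V E s c = j}"
        then show "?\<phi> c \<in> lack_vectors W U j"
          using degW by (simp add: lack_vectors_def lack_def V)
      qed
      show "?\<phi> ` lack_vectors W U j \<subseteq> {c \<in> Sto V E s. lack V E s c = j}"
      proof (rule image_subsetI)
        fix f assume f: "f \<in> lack_vectors W U j"
        let ?c = "?\<phi> f"
        have conf: "?c \<in> configurations V s"
          by (simp add: configurations_def V)
        have stable: "stable V E s ?c"
          unfolding stable_def V using bound[OF f] by fastforce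
        have "lack V E s ?c = sum f (W \<union> U)"
          unfolding lack_def V
        proof (rule sum.cong)
          fix v assume v: "v \<in> W \<union> U"
          show "vdeg E v - ?c v - 1 = f v"
            using bound[OF f v] v by simp
        qed simp
        then have "lack V E s ?c = j"
          using f by (simp add: lack_vectors_def)
        then show "?c \<in> {c \<in> Sto V E s. lack V E s c = j}"
          using Sto[OF conf stable] conf stable True by (simp add: Sto_def)
      qed
    qed
    then show ?thesis
      using True coeff by (simp add: bij_betw_same_card)
  qed
qed

section \<open>Orientations of complete bipartite graphs\<close>

text \<open>Forgetting directions maps arcs injectively to edges, since an edge never carries both
  of its arcs.\<close>

lemma orientation_card_le:
  assumes "orientation E A" "finite E"
  shows "finite A" "card A \<le> card E"
proof -
  have inj: "inj_on (\<lambda>(u, v). {u, v}) A"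
    using assms(1) by (auto simp: inj_on_def orientation_def doubleton_eq_iff)
  have sub: "(\<lambda>(u, v). {u, v}) ` A \<subseteq> E"
    using assms(1) by (auto simp: orientation_def)
  show "finite A" using inj_on_finite[OF inj sub assms(2)] .
  show "card A \<le> card E" using card_inj_on_le[OF inj sub assms(2)] .
qed

text \<open>Arcs are grouped by their heads. Only an inequality holds because arcs may point outside
  \<open>V\<close>; in the application these are the arcs into the sink.\<close>

lemma sum_indeg_le:
  assumes "finite A" "finite V"
  shows "(\<Sum>v\<in>V. indeg A v) \<le> card A"
proof -
  have fin: "finite {u. (u, v) \<in> A}" for v
    using assms(1) by (rule finite_subset[rotated, OF finite_imageI[of A fst]]) force
  have "(\<Sum>v\<in>V. indeg A v) = card (SIGMA v:V. {u. (u, v) \<in> A})"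
    using assms fin by (simp add: indeg_def)
  also have "\<dots> \<le> card A"
    by (rule card_inj_on_le[of prod.swap]) (use assms in auto)
  finally show ?thesis .
qed

text \<open>Compatibility forces in-degree at least lack plus one at each non-sink vertex; summing
  counts distinct arcs.\<close>

lemma lack_add_le_card_edges:
  assumes "stable V E s c" "orientation E A" "compatible V E s c A" "finite V" "finite E"
  shows "lack V E s c + card (V - {s}) \<le> card E"
proof -
  have "lack V E s c + card (V - {s}) = (\<Sum>v\<in>V - {s}. Suc (vdeg E v - c v - 1))"
    by (simp add: lack_def sum.distrib flip: sum_Suc)
  also have "\<dots> \<le> (\<Sum>v\<in>V - {s}. indeg A v)"
  proof (rule sum_mono)
    fix v assume "v \<in> V - {s}"
    then have "c v < vdeg E v" "int (indeg A v) \<ge> int (vdeg E v) - int (c v)"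
      using assms by (auto simp: stable_def compatible_def)
    then show "Suc (vdeg E v - c v - 1) \<le> indeg A v" by linarith
  qed
  also have "\<dots> \<le> card A"
    using orientation_card_le assms by (intro sum_indeg_le) auto
  also have "\<dots> \<le> card E"
    using orientation_card_le assms by auto
  finally show ?thesis .
qed

section \<open>Edges, degrees and orientations of complete bipartite graphs\<close>

lemma mem_K_edges_iff:
  "{u, v} \<in> K_edges m n \<longleftrightarrow> (u < m \<and> m \<le> v \<and> v < m + n) \<or> (v < m \<and> m \<le> u \<and> u < m + n)"
  by (auto simp: K_edges_def doubleton_eq_iff)

lemma K_edges_image: "K_edges m n = (\<lambda>(i, j). {i, j}) ` ({0..<m} \<times> {m..<m + n})"
  by (auto simp: mem_K_edges_iff) (auto simp: K_edges_def)

lemma finite_K_edges: "finite (K_edges m n)"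
  by (simp add: K_edges_image)

lemma card_K_edges_le: "card (K_edges m n) \<le> m * n"
  unfolding K_edges_image by (rule order.trans[OF card_image_le]) auto

lemma vdeg_K_left:
  assumes "i < m"
  shows "vdeg (K_edges m n) i = n"
proof -
  have "{e \<in> K_edges m n. i \<in> e} = (\<lambda>j. {i, j}) ` {m..<m + n}"
    using assms by (auto simp: mem_K_edges_iff) (auto simp: K_edges_def)
  moreover have "inj_on (\<lambda>j. {i, j}) {m..<m + n}"
    by (auto simp: inj_on_def doubleton_eq_iff)
  ultimately show ?thesis by (simp add: vdeg_def card_image)
qed

lemma vdeg_K_right:
  assumes "m \<le> j" "j < m + n"
  shows "vdeg (K_edges m n) j = m"
proof -
  have "{e \<in> K_edges m n. j \<in> e} = (\<lambda>i. {i, j}) ` {0..<m}"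
    using assms by (auto simp: mem_K_edges_iff) (auto simp: K_edges_def)
  moreover have "inj_on (\<lambda>i. {i, j}) {0..<m}"
    by (auto simp: inj_on_def doubleton_eq_iff)
  ultimately show ?thesis by (simp add: vdeg_def card_image)
qed

text \<open>The predicate \<open>P i j\<close> directs the edge from the left vertex
  \<open>i\<close> to the right vertex \<open>j\<close>; otherwise it points from \<open>j\<close>
  to \<open>i\<close>.\<close>

lemma K_orientation_exists:
  fixes P :: "nat \<Rightarrow> nat \<Rightarrow> bool"
  obtains A where "orientation (K_edges m n) A"
    "\<forall>i<m. indeg A i = card {j \<in> {m..<m + n}. \<not> P i j}"
    "\<forall>j\<in>{m..<m + n}. indeg A j = card {i \<in> {0..<m}. P i j}"
proof
  let ?A = "{(u, v). (u < m \<and> m \<le> v \<and> v < m + n \<and> P u v) \<or>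
                     (v < m \<and> m \<le> u \<and> u < m + n \<and> \<not> P v u)}"
  show "orientation (K_edges m n) ?A"
    by (auto simp: orientation_def mem_K_edges_iff)
  show "\<forall>i<m. indeg ?A i = card {j \<in> {m..<m + n}. \<not> P i j}"
    unfolding indeg_def by (auto intro!: arg_cong[where f = card])
  show "\<forall>j\<in>{m..<m + n}. indeg ?A j = card {i \<in> {0..<m}. P i j}"
    unfolding indeg_def by (auto intro!: arg_cong[where f = card])
qed

text \<open>The resulting bound is \<open>(m - 1) * (n - 1)\<close>, which equals \<open>N\<close>
  when the parts have 2 and \<open>Suc N\<close> vertices.\<close>

lemma K_lack_le:
  assumes "stable (K_verts m n) (K_edges m n) 0 c" "orientation (K_edges m n) A"
    "compatible (K_verts m n) (K_edges m n) 0 c A" "m \<ge> 1"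
  shows "lack (K_verts m n) (K_edges m n) 0 c + (m + n - 1) \<le> m * n"
proof -
  have "card (K_verts m n - {0}) = m + n - 1"
    using assms(4) by (simp add: K_verts_def)
  then show ?thesis
    using lack_add_le_card_edges[OF assms(1-3)] card_K_edges_le[of m n] finite_K_edges
    by (simp add: K_verts_def)
qed

lemma sum_lack_two:
  fixes c :: "'a \<Rightarrow> nat"
  assumes "finite W" "\<And>w. w \<in> W \<Longrightarrow> c w < 2"
  shows "(\<Sum>w\<in>W. 2 - c w - 1) = card {w \<in> W. c w = 0}"
proof -
  have "(\<Sum>w\<in>W. 2 - c w - 1) = (\<Sum>w\<in>W. if c w = 0 then 1 else 0)"
  proof (rule sum.cong)
    fix w assume "w \<in> W"
    then have "c w < 2" by (rule assms)
    then show "2 - c w - 1 = (if c w = 0 then 1 else 0)" by auto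
  qed simp
  then show ?thesis using assms(1) by (simp add: sum.If_cases Int_def)
qed

lemma card_split_zero:
  fixes c :: "'a \<Rightarrow> nat"
  assumes "finite W"
  shows "card {w \<in> W. c w = 0} + card {w \<in> W. c w \<noteq> 0} = card W"
  using assms by (subst card_Un_disjoint[symmetric]) (auto intro: arg_cong[where f = card])

section \<open>The two families\<close>

text \<open>Necessity is arc counting. For sufficiency the sink sends out all its edges, and each
  \<open>w\<close> with \<open>c w \<noteq> 0\<close>, needing only one incoming arc, forwards its
  other edge to vertex 1.\<close>

lemma K2n_Sto_iff:
  assumes "stable (K_verts 2 (Suc N)) (K_edges 2 (Suc N)) 0 c"
  shows "(\<exists>A. orientation (K_edges 2 (Suc N)) A \<and>
             compatible (K_verts 2 (Suc N)) (K_edges 2 (Suc N)) 0 c A) \<longleftrightarrow>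
         lack (K_verts 2 (Suc N)) (K_edges 2 (Suc N)) 0 c \<le> N"
    (is "?ex \<longleftrightarrow> ?le")
proof
  assume ?ex
  then show ?le using K_lack_le[OF assms] by fastforce
next
  assume le: ?le
  let ?E = "K_edges 2 (Suc N)" and ?W = "{2..<2 + Suc N}"
  have V: "K_verts 2 (Suc N) - {0} = insert 1 ?W"
    by (auto simp: K_verts_def)
  have d1: "vdeg ?E 1 = Suc N" by (rule vdeg_K_left) simp
  have dW: "vdeg ?E w = 2" if "w \<in> ?W" for w
    using that by (intro vdeg_K_right) auto
  have st: "c 1 < Suc N" "\<And>w. w \<in> ?W \<Longrightarrow> c w < 2"
    using assms d1 dW unfolding stable_def V by fastforce+
  have "lack (K_verts 2 (Suc N)) ?E 0 c = (Suc N - c 1 - 1) + (\<Sum>w\<in>?W. vdeg ?E w - c w - 1)"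
    unfolding lack_def V using d1 by simp
  also have "(\<Sum>w\<in>?W. vdeg ?E w - c w - 1) = (\<Sum>w\<in>?W. 2 - c w - 1)"
    using dW by (intro sum.cong) auto
  also have "\<dots> = card {w \<in> ?W. c w = 0}"
    by (rule sum_lack_two) (use st in auto)
  \<comment> \<open>The in-degree demanded by vertex 1 is at most the number of vertices able to
    forward an edge; this restates the lack bound, as \<open>?W\<close> has \<open>Suc N\<close>
    elements.\<close>
  finally have "Suc N - c 1 \<le> card {w \<in> ?W. c w \<noteq> 0}"
    using le st(1) card_split_zero[of ?W c] by simp
  obtain A where A: "orientation ?E A"
    "\<forall>i<2. indeg A i = card {j \<in> ?W. \<not> (i = 0 \<or> c j = 0)}"
    "\<forall>j\<in>?W. indeg A j = card {i \<in> {0..<2::nat}. i = 0 \<or> c j = 0}"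
    by (rule K_orientation_exists[of 2 "Suc N" "\<lambda>i j. i = 0 \<or> c j = 0"])
  have "compatible (K_verts 2 (Suc N)) ?E 0 c A"
    unfolding compatible_def V
  proof
    fix v assume "v \<in> insert 1 ?W"
    then consider "v = 1" | "v \<in> ?W" by auto
    then show "int (vdeg ?E v) - int (c v) \<le> int (indeg A v)"
    proof cases
      case 1
      have "indeg A 1 = card {w \<in> ?W. c w \<noteq> 0}"
        using A(2)[rule_format, of 1] by simp
      then show ?thesis
        using 1 d1 \<open>Suc N - c 1 \<le> card {w \<in> ?W. c w \<noteq> 0}\<close> by simp
    next
      case 2
      have "{i \<in> {0..<2}. i = 0 \<or> c v = 0} = (if c v = 0 then {0, 1} else {0 :: nat})"
        by auto
      then have "indeg A v = (if c v = 0 then 2 else 1)"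
        using A(3)[rule_format, OF 2] by simp
      then show ?thesis using dW[OF 2] by auto
    qed
  qed
  then show ?ex using A(1) by blast
qed

text \<open>Both right vertices receive an arc from the sink. Each left \<open>w\<close> with
  \<open>c w \<noteq> 0\<close> can forward one further arc, and the lack bound says that there are
  enough of these to serve both right vertices disjointly.\<close>

lemma Km2_Sto_iff:
  assumes "stable (K_verts (Suc N) 2) (K_edges (Suc N) 2) 0 c"
  shows "(\<exists>A. orientation (K_edges (Suc N) 2) A \<and>
             compatible (K_verts (Suc N) 2) (K_edges (Suc N) 2) 0 c A) \<longleftrightarrow>
         lack (K_verts (Suc N) 2) (K_edges (Suc N) 2) 0 c \<le> N"
    (is "?ex \<longleftrightarrow> ?le")
proof
  assume ?ex
  then show ?le using K_lack_le[OF assms] by fastforce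
next
  assume le: ?le
  let ?E = "K_edges (Suc N) 2" and ?W = "{1..<Suc N}" and ?p = "Suc N" and ?q = "Suc (Suc N)"
  have V: "K_verts (Suc N) 2 - {0} = insert ?p (insert ?q ?W)"
    by (auto simp: K_verts_def)
  have dU: "vdeg ?E ?p = Suc N" "vdeg ?E ?q = Suc N"
    by (rule vdeg_K_right; simp)+
  have dW: "vdeg ?E w = 2" if "w \<in> ?W" for w
    using that by (intro vdeg_K_left) auto
  have st: "c ?p < Suc N" "c ?q < Suc N" "\<And>w. w \<in> ?W \<Longrightarrow> c w < 2"
    using assms dU dW unfolding stable_def V by fastforce+
  have "lack (K_verts (Suc N) 2) ?E 0 c
      = (Suc N - c ?p - 1) + ((Suc N - c ?q - 1) + (\<Sum>w\<in>?W. vdeg ?E w - c w - 1))"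
    unfolding lack_def V using dU by simp
  also have "(\<Sum>w\<in>?W. vdeg ?E w - c w - 1) = (\<Sum>w\<in>?W. 2 - c w - 1)"
    using dW by (intro sum.cong) auto
  also have "\<dots> = card {w \<in> ?W. c w = 0}"
    by (rule sum_lack_two) (use st in auto)
  finally have free: "(N - c ?p) + (N - c ?q) \<le> card {w \<in> ?W. c w \<noteq> 0}"
    using le card_split_zero[of ?W c] by simp
  \<comment> \<open>Besides the arc from the sink, \<open>?p\<close> needs \<open>N - c ?p\<close>
    more. The set \<open>T\<close> supplies them, and the rest \<open>?R\<close> is left for
    \<open>?q\<close>.\<close>
  obtain T where T: "T \<subseteq> {w \<in> ?W. c w \<noteq> 0}" "card T = N - c ?p" and finT: "finite T"
    by (rule obtain_subset_with_card_n[OF add_leD1[OF free]])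
  let ?R = "{w \<in> ?W. c w \<noteq> 0} - T"
  have R: "card ?R \<ge> N - c ?q"
    using T free finT by (simp add: card_Diff_subset)
  let ?P = "\<lambda>i j. i = 0 \<or> (j = ?p \<and> i \<in> T) \<or> (j = ?q \<and> i \<in> ?R)"
  obtain A where A: "orientation ?E A"
    "\<forall>i<Suc N. indeg A i = card {j \<in> {Suc N..<Suc N + 2}. \<not> ?P i j}"
    "\<forall>j\<in>{Suc N..<Suc N + 2}. indeg A j = card {i \<in> {0..<Suc N}. ?P i j}"
    by (rule K_orientation_exists[of "Suc N" 2 ?P])
  have "compatible (K_verts (Suc N) 2) ?E 0 c A"
    unfolding compatible_def V
  proof
    fix v assume "v \<in> insert ?p (insert ?q ?W)"
    then consider "v = ?p" | "v = ?q" | "v \<in> ?W" by auto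
    then show "int (vdeg ?E v) - int (c v) \<le> int (indeg A v)"
    proof cases
      case 1
      have "{i \<in> {0..<Suc N}. ?P i ?p} = insert 0 T"
        using T(1) by auto
      moreover have "0 \<notin> T" using T(1) by auto
      ultimately have "indeg A ?p = Suc (N - c ?p)"
        using A(3)[rule_format, of ?p] T(2) finT by simp
      then show ?thesis using 1 dU by simp
    next
      case 2
      have "{i \<in> {0..<Suc N}. ?P i ?q} = insert 0 ?R"
        by auto
      then have "indeg A ?q = card (insert 0 ?R)"
        using A(3)[rule_format, of ?q] by simp
      also have "\<dots> = Suc (card ?R)"
        by (rule card_insert_disjoint) auto
      finally show ?thesis using 2 dU R by simp
    next
      case 3
      \<comment> \<open>A vertex with \<open>c v = 0\<close> keeps both incoming arcs. One in
        \<open>T\<close> has spent its edge to \<open>?p\<close> and one in \<open>?R\<close> its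
        edge to \<open>?q\<close>, so each of these keeps exactly one.\<close>
      have "{j \<in> {Suc N..<Suc N + 2}. \<not> ?P v j}
          = (if c v = 0 then {?p, ?q} else if v \<in> T then {?q} else {?p})"
        using 3 T(1) by auto
      then have "indeg A v = (if c v = 0 then 2 else 1)"
        using A(2)[rule_format, of v] 3 by simp
      then show ?thesis using dW[OF 3] by auto
    qed
  qed
  then show ?ex using A(1) by blast
qed

text \<open>Here \<open>W\<close> is the whole part of \<open>Suc N\<close> vertices and
  \<open>U\<close> is the single vertex 1, giving one partial summation.\<close>

lemma coeff_K2n:
  "coeff (K_lacking_poly 2 (Suc N)) j = (if j \<le> N then \<Sum>i\<le>j. real (Suc N choose i) else 0)"
proof -
  let ?W = "{2..<2 + Suc N}"
  have "coeff (K_lacking_poly 2 (Suc N)) j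
      = (if j \<le> N then real (card (lack_vectors ?W {1} j)) else 0)"
    unfolding K_lacking_poly_def
  proof (rule coeff_lacking_poly)
    show "vdeg (K_edges 2 (Suc N)) w = 2" if "w \<in> ?W" for w
      using that by (intro vdeg_K_right) auto
    show "vdeg (K_edges 2 (Suc N)) u = Suc N" if "u \<in> {1}" for u
      using that by (intro vdeg_K_left) auto
  qed ((rule K2n_Sto_iff, assumption) | (auto simp: K_verts_def; fail))+
  then show ?thesis
    by (simp add: card_lack_vectors_insert card_lack_vectors_empty)
qed

text \<open>The sink lies in the larger part, so \<open>W\<close> has only \<open>N\<close>
  vertices; the two vertices of \<open>U\<close> give two partial summations.\<close>

lemma coeff_Km2:
  "coeff (K_lacking_poly (Suc N) 2) j =
     (if j \<le> N then \<Sum>k\<le>j. \<Sum>i\<le>k. real (N choose i) else 0)"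
proof -
  let ?W = "{1..<Suc N}"
  have "coeff (K_lacking_poly (Suc N) 2) j
      = (if j \<le> N then real (card (lack_vectors ?W {Suc N, Suc (Suc N)} j)) else 0)"
    unfolding K_lacking_poly_def
  proof (rule coeff_lacking_poly)
    show "vdeg (K_edges (Suc N) 2) w = 2" if "w \<in> ?W" for w
      using that by (intro vdeg_K_left) auto
    show "vdeg (K_edges (Suc N) 2) u = Suc N" if "u \<in> {Suc N, Suc (Suc N)}" for u
      using that by (intro vdeg_K_right) auto
  qed ((rule Km2_Sto_iff, assumption) | (auto simp: K_verts_def; fail))+
  then show ?thesis
    by (simp add: card_lack_vectors_insert card_lack_vectors_empty)
qed

theorem theorem10:
  shows "(\<forall>n::nat. n \<ge> 1 \<longrightarrow> log_concave_coeffs (K_lacking_poly 2 n)) \<and>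
         (\<forall>m::nat. m \<ge> 1 \<longrightarrow> log_concave_coeffs (K_lacking_poly m 2))"
proof (intro conjI allI impI)
  fix n :: nat assume "n \<ge> 1"
  then obtain N where n: "n = Suc N" by (cases n) auto
  show "log_concave_coeffs (K_lacking_poly 2 n)"
    unfolding n
    by (rule log_concave_coeffsI, rule coeff_K2n, simp add: sum_nonneg,
        rule binomial_sum_log_concave)
next
  fix m :: nat assume "m \<ge> 1"
  then obtain N where m: "m = Suc N" by (cases m) auto
  show "log_concave_coeffs (K_lacking_poly m 2)"
    unfolding m
    by (rule log_concave_coeffsI, rule coeff_Km2, simp add: sum_nonneg,
        rule binomial_double_sum_log_concave)
qed

end
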